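(* Let $d,p\ge1$, let $\Sigma\subseteq(0,\infty)$ be nonempty, let $\mathcal{A}$ be a $p$-SCLI optimization algorithm over $\mathbb{R}^d$ with characteristic polynomial $\mathcal{L}_{\mathcal{A}}(\lambda,X)$ and inversion matrix $N(X)$, and let $A\in\mathcal{S}^d(\Sigma)$. Then $\mathcal{A}$ is consistent with respect to $A$ if and only if the following two conditions hold: 1. $\mathcal{L}_{\mathcal{A}}(1,A)=-\mathbb{E}[N(A)]\,A$; 2. $\rho_\lambda(\mathcal{L}_{\mathcal{A}}(\lambda,A))<1$.
   Context: For $\Sigma\subseteq(0,\infty)$ nonempty, $\mathcal{S}^d(\Sigma)$ is the set of real symmetric $d\times d$ matrices with all eigenvalues in $\Sigma$. For $A\in\mathcal{S}^d(\Sigma)$, $\mathbf{b}\in\mathbb{R}^d$ put $f_{A,\mathbf{b}}(\mathbf{x})=\frac12\mathbf{x}^\top A\mathbf{x}+\mathbf{b}^\top\mathbf{x}$, whose minimizer is $-A^{-1}\mathbf{b}$. A $p$-SCLI optimization algorithm $\mathcal{A}$ over $\mathbb{R}^d$ is given by $p+1$ mappings $C_0(X),\dots,C_{p-1}(X)$ (coefficient matrices) and $N(X)$ (inversion matrix) from $\mathbb{R}^{d\times d}$ to $\mathbb{R}^{d\times d}$-valued random variables. Applied to $f_{A,\mathbf{b}}$ with initialization points $\mathbf{x}^0,\dots,\mathbf{x}^{p-1}\in\mathbb{R}^{d}$ it generates $$\mathbf{x}^k=\sum_{j=0}^{p-1}C_j(A)\mathbf{x}^{k-p+j}+N(A)\mathbf{b},\qquad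 k=p,p+1,\dots,$$ where in each iteration the tuple $(C_0(A),\dots,C_{p-1}(A),N(A))$ is drawn afresh from the same law, independently of all previous realizations. The expectations $\mathbb{E}C_j(A)$ and $\mathbb{E}N(A)$ are assumed finite, and $\mathbb{E}C_0(A),\dots,\mathbb{E}C_{p-1}(A)$ are assumed simultaneously triangularizable by a real invertible matrix. $\mathcal{A}$ is consistent with respect to $A\in\mathcal{S}^d(\Sigma)$ if for every $\mathbf{b}\in\mathbb{R}^d$ and all initialization points, $\mathbb{E}\mathbf{x}^k\to-A^{-1}\mathbf{b}$ as $k\to\infty$. The characteristic polynomial of $\mathcal{A}$ is $\mathcal{L}_{\mathcal{A}}(\lambda,X)=I_d\lambda^p-\sum_{j=0}^{p-1}\mathbb{E}[C_j(X)]\lambda^j$, and its root radius is $\rho_\lambda(\mathcal{L}_{\mathcal{A}}(\lambda,X))=\max\{|\lambda'|:\lambda'\in\mathbb{C},\ \det\mathcal{L}_{\mathcal{A}}(\lambda',X)=0\}$. *)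

theory Defs
  imports "HOL-Probability.Probability"
begin

definition eigenvalues :: "real^'n^'n \<Rightarrow> real set" where
  "eigenvalues A = {\<mu>. \<exists>v. v \<noteq> 0 \<and> A *v v = \<mu> *\<^sub>R v}"

definition sym_matrices :: "real set \<Rightarrow> (real^'n^'n) set" where
  "sym_matrices \<Sigma> = {A. transpose A = A \<and> eigenvalues A \<subseteq> \<Sigma>}"

definition upper_triangular :: "real^'n::{finite,wellorder}^'n::{finite,wellorder} \<Rightarrow> bool" where
  "upper_triangular T \<longleftrightarrow> (\<forall>i j. j < i \<longrightarrow> T $ i $ j = 0)"

definition simultaneously_triangularizable ::
  "(real^'n::{finite,wellorder}^'n::{finite,wellorder}) set \<Rightarrow> bool" where
  "simultaneously_triangularizable \<B> \<longleftrightarrow>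
     (\<exists>Q :: real^'n::{finite,wellorder}^'n::{finite,wellorder}.
       invertible Q \<and> (\<forall>B\<in>\<B>. upper_triangular (matrix_inv Q ** B ** Q)))"

(* The law of the tuple (C_0(X), ..., C_{p-1}(X), N(X)) is represented by random matrices
   on one probability space; only the coefficients with index j < p are meaningful. *)
record ('w, 'n) scli =
  sample_space :: "'w measure"
  coefficient :: "nat \<Rightarrow> real^'n^'n \<Rightarrow> 'w \<Rightarrow> real^'n^'n"
  inversion :: "real^'n^'n \<Rightarrow> 'w \<Rightarrow> real^'n^'n"

definition expected_coefficient :: "('w, 'n::finite) scli \<Rightarrow> nat \<Rightarrow> real^'n^'n \<Rightarrow> real^'n^'n" where
  "expected_coefficient \<A> j X = (LINT \<omega>|sample_space \<A>. coefficient \<A> j X \<omega>)"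

definition expected_inversion :: "('w, 'n::finite) scli \<Rightarrow> real^'n^'n \<Rightarrow> real^'n^'n" where
  "expected_inversion \<A> X = (LINT \<omega>|sample_space \<A>. inversion \<A> X \<omega>)"

definition is_SCLI :: "nat \<Rightarrow> real set \<Rightarrow> ('w, 'n::{finite,wellorder}) scli \<Rightarrow> bool" where
  "is_SCLI p \<Sigma> \<A> \<longleftrightarrow>
     prob_space (sample_space \<A>) \<and>
     (\<forall>X. (\<forall>j<p. coefficient \<A> j X \<in> borel_measurable (sample_space \<A>)) \<and>
          inversion \<A> X \<in> borel_measurable (sample_space \<A>)) \<and>
     (\<forall>X\<in>sym_matrices \<Sigma>.
        (\<forall>j<p. integrable (sample_space \<A>) (coefficient \<A> j X)) \<and>
        integrable (sample_space \<A>) (inversion \<A> X) \<and>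
        simultaneously_triangularizable {expected_coefficient \<A> j X | j. j < p})"

(* Iteration k uses the sample point \<omega> k, so that under the product measure below the
   tuples used in different iterations are independent and identically distributed.
   The initialization points are x0 0, ..., x0 (p - 1). *)
fun iterate :: "nat \<Rightarrow> ('w, 'n::finite) scli \<Rightarrow> real^'n^'n \<Rightarrow> real^'n \<Rightarrow> (nat \<Rightarrow> real^'n) \<Rightarrow>
    (nat \<Rightarrow> 'w) \<Rightarrow> nat \<Rightarrow> real^'n" where
  "iterate p \<A> A b x0 \<omega> k =
     (if k < p then x0 k
      else (\<Sum>j<p. coefficient \<A> j A (\<omega> k) *v iterate p \<A> A b x0 \<omega> (k - p + j))
           + inversion \<A> A (\<omega> k) *v b)"

declare iterate.simps [simp del]

definition run_space :: "('w, 'n::finite) scli \<Rightarrow> (nat \<Rightarrow> 'w) measure" where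
  "run_space \<A> = (\<Pi>\<^sub>M k\<in>UNIV. sample_space \<A>)"

definition consistent :: "nat \<Rightarrow> ('w, 'n::finite) scli \<Rightarrow> real^'n^'n \<Rightarrow> bool" where
  "consistent p \<A> A \<longleftrightarrow>
     (\<forall>b x0. (\<lambda>k. LINT \<omega>|run_space \<A>. iterate p \<A> A b x0 \<omega> k)
               \<longlonglongrightarrow> - (matrix_inv A *v b))"

(* Polymorphic in the scalars, so that it can be evaluated at real and at complex points;
   mat c is c times the identity matrix. *)
definition char_polynomial ::
  "nat \<Rightarrow> ('w, 'n::finite) scli \<Rightarrow> 'a::real_field \<Rightarrow> real^'n^'n \<Rightarrow> 'a^'n^'n" where
  "char_polynomial p \<A> z X =
     mat (z ^ p) - (\<Sum>j<p. map_matrix of_real (expected_coefficient \<A> j X) ** mat (z ^ j))"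

(* For a monic matrix polynomial of degree p \<ge> 1 the set of roots is finite and nonempty. *)
definition root_radius :: "(complex \<Rightarrow> complex^'n^'n) \<Rightarrow> real" where
  "root_radius L = Max {cmod z | z. det (L z) = 0}"

end

theory Submission
  imports Defs "HOL-Computational_Algebra.Fundamental_Theorem_Algebra"
begin

text \<open>Because the tuple used in step \<open>k\<close> is independent of the earlier iterates, the means
  \<open>m k = E x^k\<close> obey the deterministic recurrence
  \<open>m (k + p) = \<Sum>j<p. E C_j *v m (k + j) + E N *v b\<close>. If they always converge to \<open>- A\<inverse> b\<close>, passing to
  the limit gives the first condition; taking \<open>b = 0\<close> and the real and imaginary parts of
  \<open>z^k v\<close>, with \<open>v\<close> in the kernel of \<open>L(z)\<close>, gives \<open>|z| < 1\<close>. Conversely, under the first condition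
  \<open>m k + A\<inverse> b\<close> solves the homogeneous recurrence. After triangularization its last coordinate solves a
  scalar recurrence, and every other coordinate one that is forced by the later coordinates; the
  diagonal polynomials multiply to \<open>det L\<close>, so all their roots lie in the open unit disc, and
  splitting off one linear factor at a time reduces the scalar case to order one.\<close>

subsection \<open>Scalar linear recurrences\<close>

text \<open>The influence of the starting value decays geometrically, while a forcing term that is
  eventually small can only accumulate to a small multiple of its size.\<close>

lemma tendsto_zero_first_order_recurrence:
  fixes w g :: "nat \<Rightarrow> 'a::real_normed_field"
  assumes rec: "\<And>k. w (Suc k) = r * w k + g k" and r: "norm r < 1" and g: "g \<longlonglongrightarrow> 0"
  shows "w \<longlonglongrightarrow> 0"
proof (rule LIMSEQ_I)
  fix e :: real assume "e > 0"
  define c where "c = norm r"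
  have c: "0 \<le> c" "c < 1" using r by (auto simp: c_def)
  \<comment> \<open>This threshold makes e/2 the fixed point of t -> c*t + e*(1-c)/2, so the
    accumulated forcing never exceeds e/2.\<close>
  have "e * (1 - c) / 2 > 0" using \<open>e > 0\<close> c by simp
  from LIMSEQ_D[OF g this] obtain K where K: "\<And>k. k \<ge> K \<Longrightarrow> norm (g k) < e * (1 - c) / 2" by auto
  have bound: "norm (w (K + n)) \<le> c ^ n * norm (w K) + e / 2" for n
  proof (induction n)
    case 0 then show ?case using \<open>e > 0\<close> by simp
  next
    case (Suc n)
    have "norm (w (K + Suc n)) \<le> c * norm (w (K + n)) + norm (g (K + n))"
      unfolding c_def by (metis add_Suc_right rec norm_triangle_ineq norm_mult)
    also have "\<dots> \<le> c * (c ^ n * norm (w K) + e / 2) + e * (1 - c) / 2"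
      using Suc K[of "K + n"] c by (intro add_mono mult_left_mono) auto
    also have "\<dots> = c ^ Suc n * norm (w K) + e / 2" by (simp add: field_simps)
    finally show ?case .
  qed
  have "(\<lambda>n. c ^ n * norm (w K)) \<longlonglongrightarrow> 0"
    using c by (intro tendsto_mult_left_zero LIMSEQ_realpow_zero) auto
  from LIMSEQ_D[OF this, of "e / 2"] \<open>e > 0\<close>
  obtain N where N: "\<And>n. n \<ge> N \<Longrightarrow> c ^ n * norm (w K) < e / 2" using c by (auto simp: abs_mult)
  show "\<exists>no. \<forall>n\<ge>no. norm (w n - 0) < e"
  proof (intro exI[of _ "K + N"] allI impI)
    fix n assume "K + N \<le> n"
    then have "n = K + (n - K)" "n - K \<ge> N" by auto
    with bound[of "n - K"] N[of "n - K"] show "norm (w n - 0) < e" by simp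
  qed
qed

text \<open>The polynomial in the shift operator \<open>(S u) k = u (k + 1)\<close>, applied to \<open>u\<close>.\<close>

definition shift_poly :: "'a::comm_ring_1 poly \<Rightarrow> (nat \<Rightarrow> 'a) \<Rightarrow> nat \<Rightarrow> 'a" where
  "shift_poly q u k = (\<Sum>i\<le>degree q. coeff q i * u (k + i))"

text \<open>Products of polynomials act as compositions of shift operators, so the factor X - r acts
  as S - r.\<close>

lemma shift_poly_linear_mult:
  fixes q :: "'a::idom poly"
  assumes "q \<noteq> 0"
  shows "shift_poly ([:-r, 1:] * q) u k = shift_poly q u (Suc k) - r * shift_poly q u k"
proof -
  have deg: "degree ([:-r, 1:] * q) = Suc (degree q)"
    using assms by (subst degree_mult_eq) auto
  \<comment> \<open>Both sums run to \<open>Suc (degree q)\<close> so that X*q and q can be combined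
    termwise; the extra terms have coefficient 0.\<close>
  have "shift_poly ([:-r, 1:] * q) u k =
      (\<Sum>i\<le>Suc (degree q). coeff (pCons 0 q) i * u (k + i))
      - r * (\<Sum>i\<le>Suc (degree q). coeff q i * u (k + i))"
    unfolding shift_poly_def deg
    by (simp add: algebra_simps sum_distrib_left sum_subtractf sum_negf sum.distrib del: sum.atMost_Suc)
  also have "(\<Sum>i\<le>Suc (degree q). coeff (pCons 0 q) i * u (k + i)) = shift_poly q u (Suc k)"
    unfolding shift_poly_def by (subst sum.atMost_Suc_shift) simp
  also have "(\<Sum>i\<le>Suc (degree q). coeff q i * u (k + i)) = shift_poly q u k"
    unfolding shift_poly_def by (simp add: coeff_eq_0)
  finally show ?thesis .
qed

text \<open>With q = (X - r) * q', the sequence \<open>shift_poly q' u\<close> solves a first-order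
  recurrence with ratio r and forcing term \<open>shift_poly q u\<close>. The residual is only
  assumed to tend to 0, which admits the coupling terms of a triangular system.\<close>

lemma tendsto_zero_linear_recurrence:
  fixes q :: "complex poly"
  assumes "q \<noteq> 0" "\<And>z. poly q z = 0 \<Longrightarrow> cmod z < 1" "shift_poly q u \<longlonglongrightarrow> 0"
  shows "u \<longlonglongrightarrow> 0"
  using assms
proof (induction "degree q" arbitrary: q)
  case 0
  then obtain c where q: "q = [:c:]" "c \<noteq> 0" by (metis degree_eq_zeroE pCons_0_0)
  with 0 have "(\<lambda>k. c * u k) \<longlonglongrightarrow> 0" by (simp add: shift_poly_def[abs_def])
  from tendsto_mult_left[OF this, of "inverse c"] show ?case using q by simp
next
  case (Suc n)
  have "\<not> constant (poly q)" using Suc.hyps(2) by (simp add: constant_degree)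
  then obtain r where r: "poly q r = 0" using fundamental_theorem_of_algebra by blast
  then obtain q' where q': "q = [:-r, 1:] * q'" by (metis poly_eq_0_iff_dvd dvdE)
  with Suc.prems have nz: "q' \<noteq> 0" by auto
  have "degree q = Suc (degree q')" unfolding q' using nz by (subst degree_mult_eq) auto
  with Suc.hyps have n: "n = degree q'" by simp
  have "shift_poly q' u \<longlonglongrightarrow> 0"
  proof (rule tendsto_zero_first_order_recurrence)
    show "shift_poly q' u (Suc k) = r * shift_poly q' u k + shift_poly q u k" for k
      unfolding q' shift_poly_linear_mult[OF nz] by simp
  qed (use Suc.prems r in auto)
  then show ?case using Suc.hyps(1)[OF n nz] Suc.prems(2) by (auto simp: q')
qed

subsection \<open>Matrix recurrences\<close>

lemma matrix_inv_mult:
  fixes A :: "'a::semiring_1^'n^'m"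
  assumes "invertible A"
  shows matrix_inv_right: "A ** matrix_inv A = mat 1"
    and matrix_inv_left: "matrix_inv A ** A = mat 1"
  using someI_ex[OF assms[unfolded invertible_def]] unfolding matrix_inv_def by auto

text \<open>The characteristic polynomial of the scalar recurrence u (k + p) = \<Sum>j<p. c j * u (k
  + j), taken over the complex numbers so that it splits into linear factors.\<close>

definition lag_poly :: "nat \<Rightarrow> (nat \<Rightarrow> complex) \<Rightarrow> complex poly" where
  "lag_poly p c = monom 1 p - (\<Sum>j<p. monom (c j) j)"

lemma coeff_lag_poly:
  "coeff (lag_poly p c) i = (if i = p then 1 else if i < p then - c i else 0)"
  by (auto simp: lag_poly_def coeff_sum)

lemma degree_lag_poly: "degree (lag_poly p c) = p"
  by (rule antisym[OF degree_le le_degree]) (auto simp: coeff_lag_poly)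

lemma poly_lag_poly: "poly (lag_poly p c) z = z ^ p - (\<Sum>j<p. c j * z ^ j)"
  by (simp add: lag_poly_def poly_monom poly_sum)

lemma shift_lag_poly: "shift_poly (lag_poly p c) u k = u (k + p) - (\<Sum>j<p. c j * u (k + j))"
proof -
  have "{..p} = insert p {..<p}" by auto
  then show ?thesis
    by (simp add: shift_poly_def degree_lag_poly coeff_lag_poly sum_negf)
qed

section \<open>Conjugation and determinant of the characteristic matrix polynomial\<close>

lemma map_matrix_of_real_mult:
  fixes A B :: "real^'n^'n"
  shows "map_matrix of_real (A ** B) =
    (map_matrix of_real A ** map_matrix of_real B :: 'a::real_field^'n^'n)"
  by (simp add: vec_eq_iff matrix_matrix_mult_def)

lemma map_matrix_of_real_mat:
  "map_matrix of_real (mat c :: real^'n^'n) = (mat (of_real c) :: 'a::real_field^'n^'n)"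
  by (simp add: vec_eq_iff mat_def)

lemma mat_entry: "mat c $ i $ j = (if i = j then c else 0)"
  by (simp add: mat_def)

lemma mult_mat_entry [simp]:
  fixes B :: "'a::comm_semiring_1^'n^'n"
  shows "(B ** mat c) $ i $ j = B $ i $ j * c"
  by (simp add: matrix_matrix_mult_def mat_def if_distrib if_distribR cong: if_cong)

lemma mat_mult_entry [simp]:
  fixes B :: "'a::comm_semiring_1^'n^'n"
  shows "(mat c ** B) $ i $ j = c * B $ i $ j"
  by (simp add: matrix_matrix_mult_def mat_def if_distrib if_distribR cong: if_cong)

text \<open>\<open>char_polynomial\<close> detached from the algorithm. The coefficients stay real
  while the scalar type varies: the first condition evaluates at the real number 1, the root radius
  at complex points.\<close>

definition matrix_lag_poly ::
    "nat \<Rightarrow> (nat \<Rightarrow> real^'n^'n) \<Rightarrow> 'a::real_field \<Rightarrow> 'a^'n^'n" where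
  "matrix_lag_poly p C z = mat (z ^ p) - (\<Sum>j<p. map_matrix of_real (C j) ** mat (z ^ j))"

lemma matrix_lag_poly_vec:
  fixes z :: "'a::real_field" and v :: "'a^'n"
  shows "matrix_lag_poly p C z *v v = z ^ p *s v - (\<Sum>j<p. z ^ j *s (map_matrix of_real (C j) *v v))"
proof -
  have "(\<Sum>j<p. map_matrix of_real (C j) ** mat (z ^ j)) *v v =
      (\<Sum>j<p. (map_matrix of_real (C j) ** mat (z ^ j)) *v v)"
    by (induction p) (auto simp: matrix_vector_mult_add_rdistrib)
  moreover have "mat c *v w = c *s w" for c and w :: "'a^'n"
    by (simp add: vec_eq_iff matrix_vector_mult_def mat_def if_distrib if_distribR cong: if_cong)
  ultimately show ?thesis
    by (simp add: matrix_lag_poly_def matrix_vector_mult_diff_rdistrib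
        matrix_vector_mul_assoc[symmetric] vec.scale vector_scalar_commute)
qed

text \<open>Scalar matrices commute with everything, so conjugation passes through the powers of z
  and acts on the coefficients alone.\<close>

lemma matrix_lag_poly_conj:
  fixes Q R :: "real^'n^'n"
  assumes "R ** Q = mat 1"
  shows "map_matrix of_real R ** matrix_lag_poly p C z ** map_matrix of_real Q =
    (matrix_lag_poly p (\<lambda>j. R ** C j ** Q) z :: 'a::real_field^'n^'n)"
proof -
  let ?h = "map_matrix of_real :: real^'n^'n \<Rightarrow> 'a^'n^'n"
  have RQ: "?h R ** ?h Q = mat 1"
    by (simp flip: map_matrix_of_real_mult add: assms map_matrix_of_real_mat)
  have comm: "mat c ** B = B ** mat c" for c and B :: "'a^'n^'n"
    by (simp add: vec_eq_iff mult.commute)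
  have add: "(X + Y) ** Z = X ** Z + Y ** Z" for X Y Z :: "'a^'n^'n"
    by (simp add: vec_eq_iff matrix_matrix_mult_def algebra_simps sum.distrib)
  have sum: "?h R ** (\<Sum>j<p. f j) ** ?h Q = (\<Sum>j<p. ?h R ** f j ** ?h Q)" for f
    by (induction p) (auto simp: matrix_add_ldistrib add)
  have sub: "?h R ** (X - Y) ** ?h Q = ?h R ** X ** ?h Q - ?h R ** Y ** ?h Q" for X Y
    by (simp add: vec_eq_iff matrix_matrix_mult_def algebra_simps sum_subtractf)
  have "?h R ** mat c ** ?h Q = mat c" for c
    by (metis comm RQ matrix_mul_assoc matrix_mul_rid)
  moreover have "?h R ** (X ** mat c) ** ?h Q = ?h R ** X ** ?h Q ** mat c" for X c
    by (metis comm matrix_mul_assoc)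
  ultimately show ?thesis
    by (simp add: matrix_lag_poly_def sub sum map_matrix_of_real_mult)
qed

text \<open>The matrix is itself upper triangular, and its diagonal entries are the scalar
  characteristic polynomials at z.\<close>

lemma det_matrix_lag_poly_upper_triangular:
  fixes T :: "nat \<Rightarrow> real^'n::{finite,wellorder}^'n::{finite,wellorder}"
  assumes "\<And>j. j < p \<Longrightarrow> upper_triangular (T j)"
  shows "det (matrix_lag_poly p T z) = (\<Prod>i\<in>UNIV. poly (lag_poly p (\<lambda>j. of_real (T j $ i $ i))) z)"
  using assms
  by (subst det_upperdiagonal)
     (auto simp: matrix_lag_poly_def poly_lag_poly mat_entry upper_triangular_def intro!: sum.neutral)

text \<open>The determinants of the embedded R and Q multiply to 1, so conjugation preserves the
  determinant and the triangular case applies.\<close>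

lemma det_matrix_lag_poly_triangularized:
  fixes Q R :: "real^'n::{finite,wellorder}^'n::{finite,wellorder}"
  assumes "R ** Q = mat 1" "\<And>j. j < p \<Longrightarrow> upper_triangular (R ** C j ** Q)"
  shows "det (matrix_lag_poly p C z) =
    (\<Prod>i\<in>UNIV. poly (lag_poly p (\<lambda>j. of_real ((R ** C j ** Q) $ i $ i))) z)"
proof -
  let ?h = "map_matrix of_real :: real^'n::{finite,wellorder}^'n::{finite,wellorder}
    \<Rightarrow> complex^'n::{finite,wellorder}^'n::{finite,wellorder}"
  have "det (?h R) * det (?h Q) = 1"
    by (simp flip: det_mul map_matrix_of_real_mult add: assms map_matrix_of_real_mat)
  then have "det (matrix_lag_poly p C z) = det (?h R ** matrix_lag_poly p C z ** ?h Q)"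
    by (simp add: det_mul mult.commute mult.left_commute)
  also have "\<dots> = det (matrix_lag_poly p (\<lambda>j. R ** C j ** Q) z)"
    by (simp only: matrix_lag_poly_conj[OF assms(1)])
  finally show ?thesis
    by (simp only: det_matrix_lag_poly_upper_triangular[OF assms(2)])
qed

section \<open>Back substitution in triangularized coordinates, from the last one upwards\<close>

lemma finite_card_greater_induct:
  fixes i :: "'n::{finite,linorder}"
  assumes "\<And>i. (\<And>l. i < l \<Longrightarrow> P l) \<Longrightarrow> P i"
  shows "P i"
proof (induction "card {i<..}" arbitrary: i rule: less_induct)
  case less
  have "card {l<..} < card {i<..}" if "i < l" for l
    using that by (intro psubset_card_mono) auto
  then show ?case using less assms by blast
qed

lemma tendsto_zero_matrix_recurrence:
  fixes y :: "nat \<Rightarrow> real^'n::{finite,wellorder}"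
  assumes tri: "simultaneously_triangularizable {C j | j. j < p}"
    and roots: "\<And>z :: complex. det (matrix_lag_poly p C z) = 0 \<Longrightarrow> cmod z < 1"
    and rec: "\<And>k. y (k + p) = (\<Sum>j<p. C j *v y (k + j))"
  shows "y \<longlonglongrightarrow> 0"
proof -
  from tri obtain Q :: "real^'n::{finite,wellorder}^'n::{finite,wellorder}" where Q: "invertible Q"
    and upper: "\<And>j. j < p \<Longrightarrow> upper_triangular (matrix_inv Q ** C j ** Q)"
    unfolding simultaneously_triangularizable_def by blast
  define T where "T j = matrix_inv Q ** C j ** Q" for j
  define w where "w k = matrix_inv Q *v y k" for k
  have y: "y k = Q *v w k" for k
    by (simp add: w_def matrix_vector_mul_assoc matrix_inv_right[OF Q])
  have w: "w (k + p) = (\<Sum>j<p. T j *v w (k + j))" for k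
    unfolding w_def[of "k + p"] rec T_def y[of "k + j" for j]
    by (simp add: matrix_vector_mul_assoc matrix_mul_assoc vec.sum)
  have "(\<lambda>k. w k $ i) \<longlonglongrightarrow> 0" for i
  proof (induction i rule: finite_card_greater_induct)
    fix i assume IH: "\<And>l. i < l \<Longrightarrow> (\<lambda>k. w k $ l) \<longlonglongrightarrow> 0"
    let ?q = "lag_poly p (\<lambda>j. complex_of_real (T j $ i $ i))"
    \<comment> \<open>The real coordinate is viewed as a complex sequence because the scalar lemma
      factors over the complex numbers.\<close>
    have "(\<lambda>k. complex_of_real (w k $ i)) \<longlonglongrightarrow> 0"
    proof (rule tendsto_zero_linear_recurrence)
      show "?q \<noteq> 0"
        by (metis coeff_0 coeff_lag_poly zero_neq_one)
      \<comment> \<open>A root of the i-th diagonal factor annihilates the whole product, hence the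
        determinant, and \<open>roots\<close> bounds it.\<close>
      show "cmod z < 1" if "poly ?q z = 0" for z
        using that det_matrix_lag_poly_triangularized[OF matrix_inv_left[OF Q] upper, where z = z]
        by (intro roots) (auto simp: T_def)
      \<comment> \<open>Triangularity removes the columns l < i. The diagonal term is absorbed into
        \<open>?q\<close>; the columns l > i become the forcing term, which vanishes in the limit by
        \<open>IH\<close>.\<close>
      have "(T j *v w k) $ i = T j $ i $ i * w k $ i + (\<Sum>l\<in>{i<..}. T j $ i $ l * w k $ l)"
        if "j < p" for j k
      proof -
        have "(T j *v w k) $ i = (\<Sum>l\<in>insert i {i<..}. T j $ i $ l * w k $ l)"
          unfolding matrix_vector_mult_def vec_lambda_beta
        proof (rule sum.mono_neutral_right)
          show "\<forall>l\<in>UNIV - insert i {i<..}. T j $ i $ l * w k $ l = 0"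
            using upper[OF that] by (auto simp: T_def[symmetric] upper_triangular_def)
        qed auto
        then show ?thesis by simp
      qed
      then have "w (k + p) $ i = (\<Sum>j<p. T j $ i $ i * w (k + j) $ i)
          + (\<Sum>j<p. \<Sum>l\<in>{i<..}. T j $ i $ l * w (k + j) $ l)" for k
        by (simp add: w sum.distrib)
      then have "shift_poly ?q (\<lambda>k. complex_of_real (w k $ i)) =
          (\<lambda>k. complex_of_real (\<Sum>j<p. \<Sum>l\<in>{i<..}. T j $ i $ l * w (k + j) $ l))"
        by (simp add: fun_eq_iff shift_lag_poly)
      moreover have "(\<lambda>k. \<Sum>j<p. \<Sum>l\<in>{i<..}. T j $ i $ l * w (k + j) $ l) \<longlonglongrightarrow> 0"
        using IH by (intro tendsto_null_sum tendsto_mult_right_zero LIMSEQ_ignore_initial_segment) auto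
      ultimately show "shift_poly ?q (\<lambda>k. complex_of_real (w k $ i)) \<longlonglongrightarrow> 0"
        by (simp only: tendsto_of_real_iff[of _ 0, simplified])
    qed
    then show "(\<lambda>k. w k $ i) \<longlonglongrightarrow> 0"
      by (simp only: tendsto_of_real_iff[of _ 0, simplified])
  qed
  then have "w \<longlonglongrightarrow> 0" by (intro vec_tendstoI) simp
  then have "(\<lambda>k. Q *v w k) \<longlonglongrightarrow> Q *v 0"
    by (rule bounded_linear.tendsto[OF matrix_vector_mul_bounded_linear])
  then show ?thesis by (simp flip: y)
qed


subsection \<open>Expectation of the iterates\<close>

lemma borel_measurable_matrix_vector_mult [measurable (raw)]:
  fixes F :: "'w \<Rightarrow> real^'n^'m"
  assumes "F \<in> borel_measurable M" "G \<in> borel_measurable M"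
  shows "(\<lambda>x. F x *v G x) \<in> borel_measurable M"
  using assms
  by (rule borel_measurable_continuous_Pair)
     (unfold matrix_vector_mult_def, intro continuous_intros)

lemma borel_measurable_vec_nth_comp [measurable (raw)]:
  fixes F :: "'w \<Rightarrow> 'a::euclidean_space^'n"
  assumes "F \<in> borel_measurable M"
  shows "(\<lambda>x. F x $ i) \<in> borel_measurable M"
  using assms by (rule borel_measurable_continuous_on[rotated]) (intro continuous_intros)

lemma bounded_linear_matrix_vector_mult_left:
  fixes v :: "real^'n"
  shows "bounded_linear (\<lambda>B :: real^'n^'m. B *v v)"
  by (intro linear_conv_bounded_linear[THEN iffD1] linearI)
     (simp_all add: matrix_vector_mult_add_rdistrib scaleR_matrix_vector_assoc)

text \<open>Independence is stated entrywise because \<^const>\<open>prob_space.indep_var\<close> requires both random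
  variables to have the same type.\<close>

lemma (in prob_space)
  fixes F :: "'a \<Rightarrow> real^'n^'m" and G :: "'a \<Rightarrow> real^'n"
  assumes indep: "\<And>i j. indep_var borel (\<lambda>\<omega>. F \<omega> $ i $ j) borel (\<lambda>\<omega>. G \<omega> $ j)"
    and F: "integrable M F" and G: "integrable M G"
  shows integrable_indep_matrix_vector_mult: "integrable M (\<lambda>\<omega>. F \<omega> *v G \<omega>)"
    and integral_indep_matrix_vector_mult:
      "(LINT \<omega>|M. F \<omega> *v G \<omega>) = (LINT \<omega>|M. F \<omega>) *v (LINT \<omega>|M. G \<omega>)"
proof -
  have nth_F: "integrable M (\<lambda>\<omega>. F \<omega> $ i $ j)"
    "(LINT \<omega>|M. F \<omega> $ i $ j) = (LINT \<omega>|M. F \<omega>) $ i $ j" for i j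
    using F bounded_linear_compose[OF bounded_linear_vec_nth[of j] bounded_linear_vec_nth[of i]]
    by (auto intro: integrable_bounded_linear integral_bounded_linear)
  have nth_G: "integrable M (\<lambda>\<omega>. G \<omega> $ j)"
    "(LINT \<omega>|M. G \<omega> $ j) = (LINT \<omega>|M. G \<omega>) $ j" for j
    using G bounded_linear_vec_nth[of j]
    by (auto intro: integrable_bounded_linear integral_bounded_linear)
  note int = indep_var_integrable[OF indep nth_F(1) nth_G(1)]
  \<comment> \<open>Expanding along the standard basis leaves finitely many products of independent
    real variables, to which the scalar product rule applies.\<close>
  have mult: "B *v v = (\<Sum>i\<in>UNIV. (\<Sum>j\<in>UNIV. B $ i $ j * v $ j) *\<^sub>R axis i 1)"
    for B :: "real^'n^'m" and v
    by (simp add: vec_eq_iff matrix_vector_mult_def axis_def if_distrib if_distribR cong: if_cong)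
  show int_FG: "integrable M (\<lambda>\<omega>. F \<omega> *v G \<omega>)"
    unfolding mult by (intro Bochner_Integration.integrable_sum integrable_scaleR_left int)
  show "(LINT \<omega>|M. F \<omega> *v G \<omega>) = (LINT \<omega>|M. F \<omega>) *v (LINT \<omega>|M. G \<omega>)"
    unfolding mult
    by (simp add: int indep_var_lebesgue_integral[OF indep nth_F(1) nth_G(1)] nth_F(2) nth_G(2)
        Bochner_Integration.integral_sum Bochner_Integration.integrable_sum)
qed

text \<open>Independence amounts to the joint law being the product of the marginals. Here the joint
  law is the image of the product measure under restriction to I, which is the identity on its
  space.\<close>

lemma indep_vars_PiM_coordinates:
  assumes M: "\<And>i. i \<in> I \<Longrightarrow> prob_space (M i)" and "I \<noteq> {}"
  shows "prob_space.indep_vars (PiM I M) M (\<lambda>i \<omega>. \<omega> i) I"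
proof -
  interpret prob_space "PiM I M" using M by (rule prob_space_PiM)
  have "distr (PiM I M) (PiM I M) (\<lambda>\<omega>. \<lambda>i\<in>I. \<omega> i) = distr (PiM I M) (PiM I M) (\<lambda>\<omega>. \<omega>)"
    by (intro distr_cong) (auto simp: space_PiM PiE_restrict)
  also have "\<dots> = PiM I M" by simp
  also have "\<dots> = (\<Pi>\<^sub>M i\<in>I. distr (PiM I M) (M i) (\<lambda>\<omega>. \<omega> i))"
    using M by (intro PiM_cong) (auto simp: distr_PiM_component)
  finally show ?thesis using assms
    by (subst indep_vars_iff_distr_eq_PiM') auto
qed

section \<open>Iterates as functions of the sampled path, and their means\<close>

lemma iterate_cong:
  assumes "\<And>l. l \<le> k \<Longrightarrow> \<omega> l = \<omega>' l"
  shows "iterate p \<A> A b x0 \<omega> k = iterate p \<A> A b x0 \<omega>' k"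
  using assms
proof (induction k rule: less_induct)
  case (less k)
  have "iterate p \<A> A b x0 \<omega> (k - p + j) = iterate p \<A> A b x0 \<omega>' (k - p + j)"
    if "\<not> k < p" "j < p" for j
    using that less by auto
  then show ?case
    using less.prems[of k] by (subst (1 2) iterate.simps) (auto intro!: sum.cong)
qed

text \<open>Any block of coordinates containing \<open>{..k}\<close> is allowed, because
  independence needs an iterate as a function of the earlier sample points only.\<close>

lemma borel_measurable_iterate:
  assumes [measurable]: "\<And>j. j < p \<Longrightarrow> coefficient \<A> j A \<in> borel_measurable (sample_space \<A>)"
    "inversion \<A> A \<in> borel_measurable (sample_space \<A>)" and "{..k} \<subseteq> I"
  shows "(\<lambda>\<omega>. iterate p \<A> A b x0 \<omega> k) \<in> borel_measurable (\<Pi>\<^sub>M i\<in>I. sample_space \<A>)"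
  using assms(3)
proof (induction k rule: less_induct)
  case (less k)
  have [measurable]: "k \<in> I" using less.prems by auto
  show ?case
  proof (cases "k < p")
    case True
    then show ?thesis by (subst iterate.simps) simp
  next
    case False
    have [measurable]: "(\<lambda>\<omega>. iterate p \<A> A b x0 \<omega> (k - p + j))
        \<in> borel_measurable (\<Pi>\<^sub>M i\<in>I. sample_space \<A>)"
      if "j < p" for j
      using that False less.prems by (intro less.IH) auto
    show ?thesis using False
      by (subst iterate.simps, simp only: if_False) measurable
  qed
qed

text \<open>The tuple of step k reads coordinate k and earlier iterates read smaller coordinates, so
  the expectation of each product factorizes.\<close>

lemma expectation_iterate:
  fixes \<A> :: "('w, 'n::finite) scli" and b :: "real^'n" and x0 :: "nat \<Rightarrow> real^'n"
  assumes prob: "prob_space (sample_space \<A>)"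
    and coeff: "\<And>j. j < p \<Longrightarrow> integrable (sample_space \<A>) (coefficient \<A> j A)"
    and inv: "integrable (sample_space \<A>) (inversion \<A> A)"
  defines "m \<equiv> \<lambda>k. LINT \<omega>|run_space \<A>. iterate p \<A> A b x0 \<omega> k"
  shows integrable_iterate: "integrable (run_space \<A>) (\<lambda>\<omega>. iterate p \<A> A b x0 \<omega> k)"
    and expectation_iterate_init: "k < p \<Longrightarrow> m k = x0 k"
    and expectation_iterate_step:
      "m (k + p) = (\<Sum>j<p. expected_coefficient \<A> j A *v m (k + j)) + expected_inversion \<A> A *v b"
proof -
  let ?S = "sample_space \<A>" and ?R = "run_space \<A>" and ?x = "iterate p \<A> A b x0"
  have R: "?R = PiM UNIV (\<lambda>_. ?S)" by (simp add: run_space_def)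
  interpret R: prob_space ?R unfolding R using prob by (rule prob_space_PiM)
  \<comment> \<open>Each coordinate has the law of a single draw, so integrals over runs of a
    function of one coordinate reduce to integrals over \<open>?S\<close>.\<close>
  have coord: "distr ?R ?S (\<lambda>\<omega>. \<omega> k) = ?S" for k
    unfolding R using prob by (intro distr_PiM_component) auto
  have coord_meas: "(\<lambda>\<omega>. \<omega> k) \<in> measurable ?R ?S" for k
    unfolding R by measurable
  have lift_int: "integrable ?R (\<lambda>\<omega>. f (\<omega> k))" if "integrable ?S f"
    for f :: "'w \<Rightarrow> 'c::{banach, second_countable_topology}" and k
    using that integrable_distr[OF coord_meas[of k], of f] by (simp add: coord)
  have lift_integral: "(LINT \<omega>|?R. f (\<omega> k)) = (LINT s|?S. f s)" if "integrable ?S f"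
    for f :: "'w \<Rightarrow> 'c::{banach, second_countable_topology}" and k
    using that integral_distr[OF coord_meas[of k], of f] by (simp add: coord)
  have indep: "R.indep_var borel (\<lambda>\<omega>. coefficient \<A> j A (\<omega> k) $ s $ t) borel (\<lambda>\<omega>. ?x \<omega> i $ t)"
    if "j < p" "i < k" for i j k s t
  proof -
    \<comment> \<open>The blocks \<open>{k}\<close> and \<open>{..<k}\<close> are disjoint, so the
      corresponding restrictions of the path are independent.\<close>
    have "R.indep_var (PiM {k} (\<lambda>_. ?S)) (\<lambda>\<omega>. restrict \<omega> {k})
        (PiM {..<k} (\<lambda>_. ?S)) (\<lambda>\<omega>. restrict \<omega> {..<k})"
      using R.indep_var_restrict[of "\<lambda>_. ?S" "\<lambda>i \<omega>. \<omega> i" UNIV "{k}" "{..<k}"]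
        indep_vars_PiM_coordinates[of UNIV "\<lambda>_. ?S"] prob
      by (simp add: R)
    moreover have "(\<lambda>\<omega>. coefficient \<A> j A (\<omega> k) $ s $ t) \<in> borel_measurable (PiM {k} (\<lambda>_. ?S))"
    proof -
      have [measurable]: "coefficient \<A> j A \<in> borel_measurable ?S" using coeff that by auto
      show ?thesis by measurable
    qed
    moreover have "(\<lambda>\<omega>. ?x \<omega> i $ t) \<in> borel_measurable (PiM {..<k} (\<lambda>_. ?S))"
      using that coeff inv by (intro borel_measurable_vec_nth_comp borel_measurable_iterate) auto
    ultimately have "R.indep_var borel ((\<lambda>\<omega>. coefficient \<A> j A (\<omega> k) $ s $ t) \<circ> (\<lambda>\<omega>. restrict \<omega> {k}))
        borel ((\<lambda>\<omega>. ?x \<omega> i $ t) \<circ> (\<lambda>\<omega>. restrict \<omega> {..<k}))"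
      by (rule R.indep_var_compose)
    \<comment> \<open>Restriction makes the path undefined from time k on, but an iterate with i < k
      never reads those values.\<close>
    moreover have "?x (restrict \<omega> {..<k}) i = ?x \<omega> i" for \<omega>
      using that by (intro iterate_cong) auto
    ultimately show ?thesis by (simp add: comp_def)
  qed
  \<comment> \<open>The product rule requires integrable factors, so integrability of the earlier
    iterates is carried along by strong induction.\<close>
  show int: "integrable ?R (\<lambda>\<omega>. ?x \<omega> k)" for k
  proof (induction k rule: less_induct)
    case (less k)
    show ?case
    proof (cases "k < p")
      case True
      then show ?thesis by (subst iterate.simps) simp
    next
      case False
      have "integrable ?R (\<lambda>\<omega>. coefficient \<A> j A (\<omega> k) *v ?x \<omega> (k - p + j))" if "j < p" for j
        using that False
        by (intro R.integrable_indep_matrix_vector_mult indep lift_int coeff less) auto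
      then show ?thesis using False
        by (subst iterate.simps)
           (auto intro!: Bochner_Integration.integrable_add Bochner_Integration.integrable_sum
              integrable_bounded_linear[OF bounded_linear_matrix_vector_mult_left] lift_int inv)
    qed
  qed
  show "m k = x0 k" if "k < p"
    using that by (simp add: m_def iterate.simps R.prob_space)
  let ?f = "\<lambda>j \<omega>. coefficient \<A> j A (\<omega> (k + p)) *v ?x \<omega> (k + j)"
  have f: "integrable ?R (?f j)" "(LINT \<omega>|?R. ?f j \<omega>) = expected_coefficient \<A> j A *v m (k + j)"
    if "j < p" for j
  proof -
    note hyps = indep[of j "k + j" "k + p"] lift_int[OF coeff[OF that], of "k + p"] int[of "k + j"]
    show "integrable ?R (?f j)"
      using hyps that by (intro R.integrable_indep_matrix_vector_mult) auto
    have "(LINT \<omega>|?R. ?f j \<omega>) = (LINT \<omega>|?R. coefficient \<A> j A (\<omega> (k + p))) *v m (k + j)"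
      unfolding m_def using hyps that by (intro R.integral_indep_matrix_vector_mult) auto
    then show "(LINT \<omega>|?R. ?f j \<omega>) = expected_coefficient \<A> j A *v m (k + j)"
      using lift_integral[OF coeff[OF that]] by (simp add: expected_coefficient_def)
  qed
  show "m (k + p) = (\<Sum>j<p. expected_coefficient \<A> j A *v m (k + j)) + expected_inversion \<A> A *v b"
  proof -
    have "m (k + p) = (LINT \<omega>|?R. (\<Sum>j<p. ?f j \<omega>) + inversion \<A> A (\<omega> (k + p)) *v b)"
      unfolding m_def by (subst iterate.simps) simp
    also have "\<dots> = (\<Sum>j<p. LINT \<omega>|?R. ?f j \<omega>) + (LINT \<omega>|?R. inversion \<A> A (\<omega> (k + p)) *v b)"
      by (subst Bochner_Integration.integral_add)
         (auto intro!: f Bochner_Integration.integral_sum Bochner_Integration.integrable_sum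
              integrable_bounded_linear[OF bounded_linear_matrix_vector_mult_left] lift_int inv)
    also have "(LINT \<omega>|?R. inversion \<A> A (\<omega> (k + p)) *v b) = expected_inversion \<A> A *v b"
      by (subst integral_bounded_linear[OF bounded_linear_matrix_vector_mult_left lift_int[OF inv]])
         (simp add: lift_integral[OF inv] expected_inversion_def)
    finally show ?thesis using f by simp
  qed
qed


subsection \<open>Consistency\<close>

lemma char_polynomial_eq_matrix_lag_poly:
  "char_polynomial p \<A> z X = matrix_lag_poly p (\<lambda>j. expected_coefficient \<A> j X) z"
  by (simp add: char_polynomial_def matrix_lag_poly_def)

text \<open>\<open>Max\<close> is meaningful only on a finite nonempty set. The root set is the
  union of the zero sets of the diagonal polynomials, each of degree p \<ge> 1: nonzero gives
  finiteness, nonconstant gives a root.\<close>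

lemma root_radius_less_iff:
  fixes C :: "nat \<Rightarrow> real^'n::{finite,wellorder}^'n::{finite,wellorder}"
  assumes tri: "simultaneously_triangularizable {C j | j. j < p}" and "p \<ge> 1"
  shows "root_radius (matrix_lag_poly p C) < c \<longleftrightarrow>
    (\<forall>z. det (matrix_lag_poly p C z) = 0 \<longrightarrow> cmod z < c)"
proof -
  from tri obtain Q :: "real^'n::{finite,wellorder}^'n::{finite,wellorder}" where Q: "invertible Q"
    and upper: "\<And>j. j < p \<Longrightarrow> upper_triangular (matrix_inv Q ** C j ** Q)"
    unfolding simultaneously_triangularizable_def by blast
  define q where "q i = lag_poly p (\<lambda>j. complex_of_real ((matrix_inv Q ** C j ** Q) $ i $ i))" for i
  let ?Z = "{z. det (matrix_lag_poly p C z) = 0} :: complex set"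
  have Z: "?Z = (\<Union>i. {z. poly (q i) z = 0})"
    using det_matrix_lag_poly_triangularized[OF matrix_inv_left[OF Q] upper] by (auto simp: q_def)
  have deg: "degree (q i) = p" for i by (simp add: q_def degree_lag_poly)
  then have "q i \<noteq> 0" for i using \<open>p \<ge> 1\<close> by (metis degree_0 not_one_le_zero)
  then have "finite ?Z" unfolding Z by (auto intro: poly_roots_finite)
  moreover have "\<exists>z. poly (q i) z = 0" for i
    using \<open>p \<ge> 1\<close> deg[of i] by (intro fundamental_theorem_of_algebra) (simp add: constant_degree)
  then have "?Z \<noteq> {}" unfolding Z by blast
  moreover have "root_radius (matrix_lag_poly p C) = Max (cmod ` ?Z)"
    unfolding root_radius_def by (rule arg_cong[of _ _ Max]) auto
  ultimately show ?thesis by auto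
qed

text \<open>A nonzero kernel vector would make 0 an eigenvalue, but all eigenvalues are
  positive.\<close>

lemma invertible_sym_matrix:
  assumes "A \<in> sym_matrices \<Sigma>" "\<Sigma> \<subseteq> {0<..}"
  shows "invertible A"
proof -
  have "v = 0" if "A *v v = 0" for v
  proof (rule ccontr)
    assume "v \<noteq> 0"
    with that have "0 \<in> eigenvalues A" by (auto simp: eigenvalues_def)
    with assms show False by (auto simp: sym_matrices_def)
  qed
  then show ?thesis
    unfolding invertible_left_inverse matrix_left_invertible_ker by blast
qed

lemma tendsto_zero_recurrence_imp_root_bound:
  fixes C :: "nat \<Rightarrow> real^'n^'n" and z :: complex
  assumes conv: "\<And>y. (\<And>k. y (k + p) = (\<Sum>j<p. C j *v y (k + j))) \<Longrightarrow> y \<longlonglongrightarrow> 0"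
    and "det (matrix_lag_poly p C z) = 0"
  shows "cmod z < 1"
proof -
  have "\<not> invertible (matrix_lag_poly p C z)"
    using assms(2) by (simp add: invertible_det_nz)
  then obtain v where v: "matrix_lag_poly p C z *v v = 0" "v \<noteq> 0"
    unfolding invertible_left_inverse matrix_left_invertible_ker by blast
  have z: "z ^ p * v $ i = (\<Sum>j<p. z ^ j * (\<Sum>l\<in>UNIV. of_real (C j $ i $ l) * v $ l))" for i
    using arg_cong[OF v(1)[unfolded matrix_lag_poly_vec], of "\<lambda>w. w $ i"]
    by (simp add: matrix_vector_mult_def)
  have rec: "z ^ (k + p) * v $ i =
      (\<Sum>j<p. \<Sum>l\<in>UNIV. of_real (C j $ i $ l) * (z ^ (k + j) * v $ l))" for k i
    using arg_cong[OF z[of i], of "\<lambda>x. z ^ k * x"]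
    by (simp add: sum_distrib_left power_add mult_ac)
  have of_real_sel: "Re (of_real a * w) = a * Re w" "Im (of_real a * w) = a * Im w" for a w
    by simp_all
  \<comment> \<open>The coefficients are real, so the real and imaginary parts of the complex
    solution are separately real solutions; \<open>times_complex.sel\<close> is disabled to keep z^k
    * v $ i unexpanded.\<close>
  have "(\<lambda>k. \<chi> i. Re (z ^ k * v $ i)) \<longlonglongrightarrow> 0"
    by (rule conv) (simp add: vec_eq_iff rec matrix_vector_mult_def of_real_sel del: times_complex.sel)
  moreover have "(\<lambda>k. \<chi> i. Im (z ^ k * v $ i)) \<longlonglongrightarrow> 0"
    by (rule conv) (simp add: vec_eq_iff rec matrix_vector_mult_def of_real_sel del: times_complex.sel)
  ultimately have lim: "(\<lambda>k. z ^ k * v $ i) \<longlonglongrightarrow> 0" for i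
    unfolding tendsto_complex_iff by (auto dest: tendsto_vec_nth[of _ _ _ i] simp del: times_complex.sel)
  from v(2) obtain i where "v $ i \<noteq> 0" by (auto simp: vec_eq_iff)
  then have "(\<lambda>k. z ^ k) \<longlonglongrightarrow> 0"
    using tendsto_mult_right[OF lim[of i], of "inverse (v $ i)"] by (simp add: field_simps)
  \<comment> \<open>One power of modulus below 1 suffices: cmod z \<ge> 1 would keep all powers at
    least 1.\<close>
  from LIMSEQ_D[OF this zero_less_one] obtain k where "cmod z ^ k < 1"
    by (auto simp: norm_power)
  then show ?thesis using one_le_power[of "cmod z" k] by linarith
qed

theorem theorem5:
  fixes p :: nat
    and \<Sigma> :: "real set"
    and \<A> :: "('w, 'n::{finite,wellorder}) scli"
    and A :: "real^'n::{finite,wellorder}^'n::{finite,wellorder}"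
  assumes "p \<ge> 1"
    and "\<Sigma> \<noteq> {}"
    and "\<Sigma> \<subseteq> {0<..}"
    and "is_SCLI p \<Sigma> \<A>"
    and "A \<in> sym_matrices \<Sigma>"
  shows "consistent p \<A> A \<longleftrightarrow>
    char_polynomial p \<A> (1::real) A = - (expected_inversion \<A> A ** A) \<and>
    root_radius (\<lambda>z. char_polynomial p \<A> z A) < 1"
proof -
  define C where "C = (\<lambda>j. expected_coefficient \<A> j A)"
  define N where "N = expected_inversion \<A> A"
  define m where "m b x0 k = (LINT \<omega>|run_space \<A>. iterate p \<A> A b x0 \<omega> k)" for b x0 k
  have prob: "prob_space (sample_space \<A>)"
    and coeff: "\<And>j. j < p \<Longrightarrow> integrable (sample_space \<A>) (coefficient \<A> j A)"
    and inv: "integrable (sample_space \<A>) (inversion \<A> A)"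
    and tri: "simultaneously_triangularizable {C j | j. j < p}"
    using assms(4,5) unfolding is_SCLI_def C_def by auto
  have init: "m b x0 k = x0 k" if "k < p" for b x0 k
    unfolding m_def using expectation_iterate_init[OF prob coeff inv that] .
  have step: "m b x0 (k + p) = (\<Sum>j<p. C j *v m b x0 (k + j)) + N *v b" for b x0 k
    unfolding m_def C_def N_def using expectation_iterate_step[OF prob coeff inv] .
  have A: "invertible A" using invertible_sym_matrix assms by blast
  have char: "char_polynomial p \<A> z A = matrix_lag_poly p C z" for z :: "'a::real_field"
    by (simp add: char_polynomial_eq_matrix_lag_poly C_def)
  have L1: "matrix_lag_poly p C (1::real) *v v = v - (\<Sum>j<p. C j *v v)" for v
  proof -
    have "map_matrix of_real B = B" for B :: "real^'n::{finite,wellorder}^'n::{finite,wellorder}"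
      by (simp add: vec_eq_iff)
    then show ?thesis by (simp add: matrix_lag_poly_vec)
  qed
  have neg: "- B *v v = - (B *v v)" for B :: "real^'n::{finite,wellorder}^'n::{finite,wellorder}" and v
    by (simp add: vec_eq_iff matrix_vector_mult_def sum_negf)
  have cons: "consistent p \<A> A \<longleftrightarrow> (\<forall>b x0. m b x0 \<longlonglongrightarrow> - (matrix_inv A *v b))"
    by (simp add: consistent_def m_def[abs_def])
  show ?thesis
    unfolding char root_radius_less_iff[OF tri \<open>p \<ge> 1\<close>] cons N_def[symmetric]
  proof safe
    assume lim: "\<forall>b x0. m b x0 \<longlonglongrightarrow> - (matrix_inv A *v b)"
    have "matrix_lag_poly p C (1::real) *v v = - (N ** A) *v v" for v
    proof -
      \<comment> \<open>The choice b = A v makes the limit -v with v arbitrary; any starting points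
        would do, and zero is taken.\<close>
      let ?m = "m (A *v v) (\<lambda>_. 0)"
      have "matrix_inv A *v (A *v v) = v"
        by (simp add: matrix_vector_mul_assoc matrix_inv_left[OF A])
      then have m: "?m \<longlonglongrightarrow> - v" using lim by metis
      have "(\<lambda>k. (\<Sum>j<p. C j *v ?m (k + j)) + N *v (A *v v)) \<longlonglongrightarrow>
          (\<Sum>j<p. C j *v - v) + N *v (A *v v)"
        by (intro tendsto_intros bounded_linear.tendsto[OF matrix_vector_mul_bounded_linear]
            LIMSEQ_ignore_initial_segment m)
      moreover have "(\<lambda>k. ?m (k + p)) \<longlonglongrightarrow> - v"
        by (intro LIMSEQ_ignore_initial_segment m)
      ultimately have "- v = (\<Sum>j<p. C j *v - v) + N *v (A *v v)"
        unfolding step by (rule LIMSEQ_unique[symmetric])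
      then show ?thesis
        unfolding L1
        by (simp add: vec.neg sum_negf matrix_vector_mul_assoc neg algebra_simps)
    qed
    then show "matrix_lag_poly p C (1::real) = - (N ** A)"
      by (simp add: matrix_eq)
  next
    fix z :: complex
    assume lim: "\<forall>b x0. m b x0 \<longlonglongrightarrow> - (matrix_inv A *v b)"
      and "det (matrix_lag_poly p C z) = 0"
    from _ this(2) show "cmod z < 1"
    proof (rule tendsto_zero_recurrence_imp_root_bound)
      fix y :: "nat \<Rightarrow> real^'n::{finite,wellorder}"
      assume y: "\<And>k. y (k + p) = (\<Sum>j<p. C j *v y (k + j))"
      \<comment> \<open>With b = 0 and the first p values of y as starting points, the means satisfy
        the same recurrence as y and agree with it.\<close>
      have "m 0 y k = y k" for k
      proof (induction k rule: less_induct)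
        case (less k)
        show ?case
        proof (cases "k < p")
          case False
          then obtain k' where k: "k = k' + p" by (metis add.commute le_Suc_ex not_less)
          then show ?thesis using less by (simp add: step y)
        qed (simp add: init)
      qed
      then have "m 0 y = y" by auto
      then show "y \<longlonglongrightarrow> 0" using lim[rule_format, of 0 y] by simp
    qed
  next
    fix b x0
    assume L: "matrix_lag_poly p C (1::real) = - (N ** A)"
      and roots: "\<forall>z. det (matrix_lag_poly p C z) = 0 \<longrightarrow> cmod z < 1"
    \<comment> \<open>The minimizer is -v, so \<open>m b x0 k + v\<close> is the error of the
      mean.\<close>
    define v where "v = matrix_inv A *v b"
    have "N *v b = N *v (A *v v)"
      by (simp add: v_def matrix_vector_mul_assoc matrix_inv_right[OF A])
    also have "\<dots> = - (v - (\<Sum>j<p. C j *v v))"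
      unfolding L1[symmetric] L by (simp add: matrix_vector_mul_assoc neg)
    \<comment> \<open>This says that -v is a fixed point of the affine recurrence, which makes the
      error recurrence homogeneous.\<close>
    finally have Nb: "N *v b = (\<Sum>j<p. C j *v v) - v" by simp
    have "(\<lambda>k. m b x0 k + v) \<longlonglongrightarrow> 0"
    proof (rule tendsto_zero_matrix_recurrence[OF tri])
      show "m b x0 (k + p) + v = (\<Sum>j<p. C j *v (m b x0 (k + j) + v))" for k
        by (simp add: step Nb matrix_vector_right_distrib sum.distrib)
    qed (use roots in blast)
    from tendsto_diff[OF this tendsto_const[of v]]
    show "m b x0 \<longlonglongrightarrow> - (matrix_inv A *v b)" by (simp add: v_def)
  qed
qed

end
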